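(* Let $m\geq 6$. Then $\kappa_2(T(m))=3m-9$. Moreover, the only disconnecting sets $S$ of $T(m)$ of size $3m-9$ such that every component of $T(m)\setminus S$ has at least two vertices are, modulo a permutation of $[m]=\{1,\dots,m\}$, the set $N(\{\{1,2\},\{1,3\},\{2,3\}\})$ of vertices adjacent to at least one of the vertices $\{1,2\}$, $\{1,3\}$, $\{2,3\}$.
   Context: The triangular graph $T(m)$ has as vertices the $2$-subsets of $[m]=\{1,\dots,m\}$, two being adjacent if and only if they intersect in exactly one element. For a graph $G$ and $X\subset V(G)$, $N(X)=\{y\notin X: y\sim x\text{ for some }x\in X\}$. A disconnecting set of a connected graph $G$ is a set $S$ of vertices such that $G\setminus S$ is disconnected. $\kappa_2(G)$ denotes the minimum size of a disconnecting set $S$ of $G$ such that every component of $G\setminus S$ has at least two vertices. *)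

theory Defs
  imports
    "Graph_Theory.Digraph_Component"
    "HOL-Combinatorics.Permutations"
    "HOL-Library.Extended_Nat"
begin

text \<open>
  As usual in Graph-Theory, a finite simple graph is a finite symmetric digraph without loops and
  parallel arcs (locale \<^locale>\<open>graph\<close>); an edge is a pair of opposite arcs.
\<close>

definition triangular_graph :: "nat \<Rightarrow> (nat set, nat set \<times> nat set) pre_digraph" where
  "triangular_graph m = with_proj
     \<lparr> pverts = {e. e \<subseteq> {1..m} \<and> card e = 2},
       parcs = {(e, f). e \<subseteq> {1..m} \<and> card e = 2 \<and> f \<subseteq> {1..m} \<and> card f = 2 \<and> card (e \<inter> f) = 1} \<rparr>"

lemma graph_triangular_graph: "graph (triangular_graph m)"
proof -
  let ?V = "{e. e \<subseteq> {1..m} \<and> card e = 2}"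
  let ?A = "{(e, f). e \<subseteq> {1..m} \<and> card e = 2 \<and> f \<subseteq> {1..m} \<and> card f = 2 \<and> card (e \<inter> f) = 1}"
  have "finite ?V" by (rule finite_subset[of _ "Pow {1..m}"]) auto
  moreover from this have "finite ?A" by (rule finite_subset[of _ "?V \<times> ?V", rotated, OF finite_cartesian_product]) auto
  ultimately show ?thesis
    unfolding triangular_graph_def
    by unfold_locales (auto simp: symmetric_def sym_def Int_commute arc_to_ends_def)
qed

definition neighbours :: "('a, 'b) pre_digraph \<Rightarrow> 'a set \<Rightarrow> 'a set" where
  "neighbours G X = {y \<in> verts G - X. \<exists>x\<in>X. y \<rightarrow>\<^bsub>G\<^esub> x}"

definition delete_verts :: "('a, 'b) pre_digraph \<Rightarrow> 'a set \<Rightarrow> ('a, 'b) pre_digraph" where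
  "delete_verts G S = G \<restriction> (verts G - S)"

text \<open>
  The empty graph is not \<^const>\<open>connected\<close> in Graph-Theory, so the degenerate
  choice of all vertices has to be excluded explicitly.
\<close>

definition disconnecting_set :: "('a, 'b) pre_digraph \<Rightarrow> 'a set \<Rightarrow> bool" where
  "disconnecting_set G S \<longleftrightarrow>
     connected G \<and> S \<subset> verts G \<and> \<not> connected (delete_verts G S)"

definition component :: "('a, 'b) pre_digraph \<Rightarrow> ('a, 'b) pre_digraph \<Rightarrow> bool" where
  "component G C \<longleftrightarrow> pre_digraph.max_subgraph G connected C"

definition disconnecting_set2 :: "('a, 'b) pre_digraph \<Rightarrow> 'a set \<Rightarrow> bool" where
  "disconnecting_set2 G S \<longleftrightarrow> disconnecting_set G S \<and>
     (\<forall>C. component (delete_verts G S) C \<longrightarrow> card (verts C) \<ge> 2)"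

text \<open>
  Intended for finite graphs (all cardinalities are taken with \<^const>\<open>card\<close>). The value is
  \<open>\<infinity>\<close> if there is no set of the required kind; otherwise the infimum is a minimum.
\<close>

definition kappa2 :: "('a, 'b) pre_digraph \<Rightarrow> enat" where
  "kappa2 G = (INF S \<in> {S. disconnecting_set2 G S}. enat (card S))"

end

theory Submission
  imports Defs
begin

text \<open>
  A set of vertices of \<open>T(m)\<close> is the edge set of a graph \<open>H\<close> on \<open>{1..m}\<close>, and the components of the
  induced subgraph of \<open>T(m)\<close> are the edge sets of the components of \<open>H\<close> that are not single points.
  If all of these have at least two edges and there are at least two of them, then the points
  covered by one of them form a set \<open>A\<close> such that \<open>A\<close> and its complement have at least three
  elements, and no edge of \<open>H\<close> joins \<open>A\<close> to its complement. Hence the removed set contains at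
  least \<open>|A| (m - |A|) \<ge> 3 (m - 3)\<close> vertices, with equality only if \<open>A\<close> or its complement has
  exactly three elements and the removed vertices are precisely the pairs joining the two parts.
\<close>

section \<open>Components and isolated vertices\<close>

context sym_digraph
begin

text \<open>The library defines \<open>connected\<close> as strong connectivity of the symmetric
  closure, and a symmetric digraph has the same reachability as its closure.\<close>

lemma connected_iff_reachable:
  "connected G \<longleftrightarrow> verts G \<noteq> {} \<and> (\<forall>u\<in>verts G. \<forall>v\<in>verts G. u \<rightarrow>\<^sup>* v)"
  unfolding connected_def strongly_connected_def
  by (simp add: reachable_mk_symmetric_eq[OF sym_arcs])

lemma sym_digraph_induce:
  assumes "V \<subseteq> verts G"
  shows "sym_digraph (G \<restriction> V)"
  using induced_induce[OF assms] by (rule induced_graph_imp_graph)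

text \<open>\<open>H\<close> itself may fail to be symmetric, so the walk is first found in its
  symmetric closure, which lies in that of \<open>G\<close>.\<close>

lemma connected_subgraph_reachable:
  assumes "subgraph H G" "connected H" "u \<in> verts H" "v \<in> verts H"
  shows "u \<rightarrow>\<^sup>* v"
proof -
  have "u \<rightarrow>\<^sup>*\<^bsub>mk_symmetric H\<^esub> v"
    using assms by (simp add: connected_def strongly_connected_def)
  then have "u \<rightarrow>\<^sup>*\<^bsub>mk_symmetric G\<^esub> v"
    using subgraph_mk_symmetric[OF assms(1)] by (rule pre_digraph.reachable_mono)
  then show ?thesis
    by (simp only: reachable_mk_symmetric_eq[OF sym_arcs])
qed

text \<open>A connected subgraph through \<open>u\<close> cannot leave the reachability class of
  \<open>u\<close>, and the induced subgraph already has all arcs inside that class; hence it is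
  maximal.\<close>

lemma component_induce_reachable:
  assumes u: "u \<in> verts G"
  shows "component G (G \<restriction> {w. u \<rightarrow>\<^sup>* w})"
proof -
  let ?R = "{w. u \<rightarrow>\<^sup>* w}"
  have R: "?R \<subseteq> verts G"
    by (auto dest: reachable_in_verts)
  interpret R: sym_digraph "G \<restriction> ?R"
    using R by (rule sym_digraph_induce)
  have reach: "u \<rightarrow>\<^sup>*\<^bsub>G \<restriction> ?R\<^esub> w" if "w \<in> ?R" for w
    using that induce_reachable_preserves_paths by simp
  have "connected (G \<restriction> ?R)"
    unfolding R.connected_iff_reachable
    using u R.reachable_trans[OF R.symmetric_reachable'[OF reach] reach] by auto
  moreover have "H = G \<restriction> ?R"
    if sub: "subgraph (G \<restriction> ?R) H" and H: "subgraph H G" "connected H" for H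
  proof -
    have uH: "u \<in> verts H"
      using sub u by (auto elim!: subgraphE)
    have verts: "verts H = ?R"
      using connected_subgraph_reachable[OF H uH] sub by (auto elim!: subgraphE)
    interpret H: wf_digraph H
      using H(1) by (auto elim!: subgraphE)
    have ends: "tail H = tail G" "head H = head G"
      using H(1) by (auto simp: compatible_def elim!: subgraphE)
    \<comment> \<open>Well-formedness of \<open>H\<close> puts the ends of its arcs into
      \<open>verts H\<close>, which is the class \<open>?R\<close>.\<close>
    have "arcs H \<subseteq> arcs (G \<restriction> ?R)"
    proof
      fix a assume a: "a \<in> arcs H"
      then have "tail H a \<in> ?R" "head H a \<in> ?R"
        using H.tail_in_verts[OF a] H.head_in_verts[OF a] unfolding verts by auto
      moreover have "a \<in> arcs G"
        using a H(1) by (auto elim!: subgraphE)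
      ultimately show "a \<in> arcs (G \<restriction> ?R)"
        by (simp add: ends)
    qed
    moreover have "arcs (G \<restriction> ?R) \<subseteq> arcs H"
      using sub by (auto elim!: subgraphE)
    ultimately show ?thesis
      using verts ends by (intro pre_digraph.equality) auto
  qed
  ultimately show ?thesis
    unfolding component_def max_subgraph_def
    using subgraph_induce_subgraphI[OF R] by blast
qed

end

text \<open>Reduces the condition on maximal subgraphs to the absence of isolated vertices. A
  one-vertex component \<open>{u}\<close> would be properly contained in the connected subgraph
  induced by \<open>u\<close> and a neighbour.\<close>

lemma (in graph) component_card_ge_2_iff:
  "(\<forall>C. component G C \<longrightarrow> card (verts C) \<ge> 2) \<longleftrightarrow> (\<forall>u\<in>verts G. \<exists>v. u \<rightarrow> v)"
proof
  assume *: "\<forall>C. component G C \<longrightarrow> card (verts C) \<ge> 2"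
  show "\<forall>u\<in>verts G. \<exists>v. u \<rightarrow> v"
  proof
    fix u assume "u \<in> verts G"
    then have card: "card {w. u \<rightarrow>\<^sup>* w} \<ge> 2"
      using * component_induce_reachable by fastforce
    then have "\<not> {w. u \<rightarrow>\<^sup>* w} \<subseteq> {u}"
      using card_mono[of "{u}" "{w. u \<rightarrow>\<^sup>* w}"] by auto
    then obtain w where "u \<rightarrow>\<^sup>* w" "w \<noteq> u"
      by blast
    \<comment> \<open>The first arc of a walk from \<open>u\<close> to a different vertex
      \<open>w\<close> yields the neighbour.\<close>
    then show "\<exists>v. u \<rightarrow> v"
      by (auto elim: converse_reachable_cases)
  qed
next
  assume *: "\<forall>u\<in>verts G. \<exists>v. u \<rightarrow> v"
  show "\<forall>C. component G C \<longrightarrow> card (verts C) \<ge> 2"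
  proof (intro allI impI)
    fix C assume "component G C"
    then have sub: "subgraph C G" and conn: "connected C"
      and max: "\<And>H. subgraph C H \<Longrightarrow> subgraph H G \<Longrightarrow> connected H \<Longrightarrow> H = C"
      unfolding component_def max_subgraph_def by blast+
    obtain u where u: "u \<in> verts C"
      using conn unfolding connected_def strongly_connected_def by auto
    have CG: "verts C \<subseteq> verts G" "arcs C \<subseteq> arcs G" "compatible G C"
      using sub by (auto elim!: subgraphE)
    interpret C: wf_digraph C
      using sub by (auto elim!: subgraphE)
    \<comment> \<open>Finiteness matters because \<open>card\<close> of an infinite set is
      0.\<close>
    have fin: "finite (verts C)"
      using CG(1) finite_verts by (rule finite_subset)
    show "card (verts C) \<ge> 2"
    proof (rule ccontr)
      assume "\<not> card (verts C) \<ge> 2"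
      moreover have "card (verts C) > 0"
        using u fin by (auto simp: card_gt_0_iff)
      ultimately have "card (verts C) = 1"
        by simp
      then have C: "verts C = {u}"
        using u by (auto simp: card_1_singleton_iff)
      obtain v where v: "u \<rightarrow> v"
        using * u CG(1) by auto
      then have uv: "u \<in> verts G" "v \<in> verts G" "u \<noteq> v"
        by (auto dest: adj_in_verts adj_not_same)
      let ?W = "{u, v}"
      have W: "?W \<subseteq> verts G"
        using uv by simp
      interpret W: sym_digraph "G \<restriction> ?W"
        using W by (rule sym_digraph_induce)
      have "u \<rightarrow>\<^bsub>G \<restriction> ?W\<^esub> v"
        using v by (auto simp: arcs_ends_conv)
      then have "connected (G \<restriction> ?W)"
        unfolding W.connected_iff_reachable
        by (auto intro: W.symmetric_reachable')
      moreover have "subgraph C (G \<restriction> ?W)"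
      proof (rule subgraphI)
        show "arcs C \<subseteq> arcs (G \<restriction> ?W)"
        proof
          fix a assume a: "a \<in> arcs C"
          then have "tail C a = u" "head C a = u"
            using C.tail_in_verts[OF a] C.head_in_verts[OF a] C by auto
          with a CG show "a \<in> arcs (G \<restriction> ?W)"
            by (auto simp: compatible_def)
        qed
      qed (use C CG W.wf_digraph_axioms C.wf_digraph_axioms in \<open>auto simp: compatible_def\<close>)
      ultimately have "G \<restriction> ?W = C"
        using max subgraph_induce_subgraphI[OF W] by blast
      then have "verts C = ?W"
        by auto
      with C uv show False
        by auto
    qed
  qed
qed

section \<open>Pairs joining two sets\<close>

definition edges_between :: "'a set \<Rightarrow> 'a set \<Rightarrow> 'a set set" where
  "edges_between A B = (\<lambda>(a, b). {a, b}) ` (A \<times> B)"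

lemma in_edges_between_iff: "e \<in> edges_between A B \<longleftrightarrow> (\<exists>a\<in>A. \<exists>b\<in>B. e = {a, b})"
  by (auto simp: edges_between_def)

lemma edges_between_commute: "edges_between A B = edges_between B A"
proof -
  have "(\<exists>a\<in>A. \<exists>b\<in>B. e = {a, b}) \<longleftrightarrow> (\<exists>a\<in>B. \<exists>b\<in>A. e = {b, a})" for e
    by blast
  then show ?thesis
    by (simp add: set_eq_iff in_edges_between_iff insert_commute)
qed

lemma edges_between_UN: "edges_between A B = (\<Union>a\<in>A. (\<lambda>b. {a, b}) ` B)"
  by (auto simp: edges_between_def)

lemma image_edges_between: "(`) f ` edges_between A B = edges_between (f ` A) (f ` B)"
  by (simp add: edges_between_UN image_UN image_image)

lemma card_edges_between:
  assumes "A \<inter> B = {}"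
  shows "card (edges_between A B) = card A * card B"
proof -
  have "inj_on (\<lambda>(a, b). {a, b}) (A \<times> B)"
    using assms by (auto simp: inj_on_def doubleton_eq_iff)
  then show ?thesis
    unfolding edges_between_def by (simp add: card_image card_cartesian_product)
qed

text \<open>Glues a bijection from \<open>A\<close> to \<open>B\<close> with one between the
  complements, and fixes everything outside \<open>S\<close>.\<close>

lemma permutes_extend_card_eq:
  assumes "finite S" "A \<subseteq> S" "B \<subseteq> S" "card A = card B"
  obtains \<pi> where "\<pi> permutes S" "\<pi> ` A = B"
proof -
  have fin: "finite A" "finite B"
    using assms finite_subset by auto
  obtain f where f: "bij_betw f A B"
    using fin assms(4) finite_same_card_bij by blast
  have "card (S - A) = card (S - B)"
    using assms fin by (simp add: card_Diff_subset)
  then obtain g where g: "bij_betw g (S - A) (S - B)"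
    using assms(1) finite_same_card_bij by blast
  define \<pi> where "\<pi> x = (if x \<in> S then if x \<in> A then f x else g x else x)" for x
  have "bij_betw (\<lambda>x. if x \<in> A then f x else g x) (A \<union> (S - A)) (B \<union> (S - B))"
    using f g by (rule bij_betw_disjoint_Un) auto
  then have "bij_betw (\<lambda>x. if x \<in> A then f x else g x) S S"
    using assms by (simp add: Un_absorb1)
  then have "bij_betw \<pi> S S"
    by (rule bij_betw_cong[THEN iffD1, rotated]) (simp add: \<pi>_def)
  then have "\<pi> permutes S"
    by (rule bij_imp_permutes) (simp add: \<pi>_def)
  moreover have "\<pi> ` A = f ` A"
    using assms by (intro image_cong) (auto simp: \<pi>_def)
  ultimately show ?thesis
    using that f by (simp add: bij_betw_def)
qed

text \<open>With \<open>a = 3 + x\<close> and \<open>b = 3 + y\<close> the product is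
  \<open>3 * m - 9 + x * y\<close>, so equality forces \<open>x = 0\<close> or
  \<open>y = 0\<close>.\<close>

lemma mult_ge_if_sum_eq:
  fixes a b m :: nat
  assumes "a + b = m" "a \<ge> 3" "b \<ge> 3"
  shows "a * b \<ge> 3 * m - 9" and "a * b = 3 * m - 9 \<Longrightarrow> a = 3 \<or> b = 3"
proof -
  obtain x y where "a = 3 + x" "b = 3 + y"
    using assms by (metis le_Suc_ex)
  then have "a * b = 3 * m - 9 + x * y" "a = 3 \<longleftrightarrow> x = 0" "b = 3 \<longleftrightarrow> y = 0"
    using assms by (auto simp: algebra_simps)
  then show "a * b \<ge> 3 * m - 9" and "a * b = 3 * m - 9 \<Longrightarrow> a = 3 \<or> b = 3"
    by auto
qed

section \<open>Disconnecting sets of the triangular graph\<close>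

lemma verts_triangular_graph: "verts (triangular_graph m) = {e. e \<subseteq> {1..m} \<and> card e = 2}"
  by (simp add: triangular_graph_def)

lemma pair_in_verts_triangular_graph:
  "{a, b} \<in> verts (triangular_graph m) \<longleftrightarrow> a \<noteq> b \<and> a \<in> {1..m} \<and> b \<in> {1..m}"
  by (auto simp: verts_triangular_graph card_insert_if)

lemma verts_triangular_graphE:
  assumes "e \<in> verts (triangular_graph m)"
  obtains a b where "e = {a, b}" "a \<noteq> b" "a \<in> {1..m}" "b \<in> {1..m}"
proof -
  obtain a b where e: "e = {a, b}"
    using assms by (auto simp: verts_triangular_graph card_2_iff)
  have "a \<noteq> b" "a \<in> {1..m}" "b \<in> {1..m}"
    using assms by (simp_all add: e pair_in_verts_triangular_graph)
  then show ?thesis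
    by (rule that[OF e])
qed

lemma adj_triangular_graph:
  "e \<rightarrow>\<^bsub>triangular_graph m\<^esub> f \<longleftrightarrow>
    e \<in> verts (triangular_graph m) \<and> f \<in> verts (triangular_graph m) \<and> card (e \<inter> f) = 1"
  by (auto simp: triangular_graph_def arcs_ends_conv)

text \<open>Stated with \<open>Suc 0\<close>, the form into which the simplifier turns 1, so that it
  can rewrite adjacency.\<close>

lemma card_Int_eq_Suc_0_iff:
  assumes "card e = 2" "card f = 2"
  shows "card (e \<inter> f) = Suc 0 \<longleftrightarrow> e \<noteq> f \<and> e \<inter> f \<noteq> {}"
proof -
  obtain a b c d where "e = {a, b}" "a \<noteq> b" "f = {c, d}" "c \<noteq> d"
    using assms by (meson card_2_iff)
  then show ?thesis
    by (auto simp: doubleton_eq_iff Int_insert_left)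
qed

text \<open>Two disjoint pairs have a common neighbour, which takes one point from each.\<close>

lemma connected_triangular_graph:
  assumes "m \<ge> 2"
  shows "connected (triangular_graph m)"
proof -
  interpret graph "triangular_graph m"
    by (rule graph_triangular_graph)
  let ?V = "verts (triangular_graph m)"
  have meet: "e \<rightarrow>\<^sup>*\<^bsub>triangular_graph m\<^esub> f" if "e \<in> ?V" "f \<in> ?V" "e \<inter> f \<noteq> {}" for e f
  proof (cases "e = f")
    case False
    then have "e \<rightarrow>\<^bsub>triangular_graph m\<^esub> f"
      using that by (simp add: adj_triangular_graph verts_triangular_graph card_Int_eq_Suc_0_iff)
    then show ?thesis
      by (rule reachable_adjI)
  qed (use that in simp)
  have "e \<rightarrow>\<^sup>*\<^bsub>triangular_graph m\<^esub> f" if ef: "e \<in> ?V" "f \<in> ?V" for e f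
  proof (cases "e \<inter> f = {}")
    case True
    obtain a c where ac: "a \<in> e" "c \<in> f"
      using ef by (metis insertI1 verts_triangular_graphE)
    have "a \<noteq> c"
      using ac True by blast
    moreover have "e \<subseteq> {1..m}" "f \<subseteq> {1..m}"
      using ef by (simp_all add: verts_triangular_graph)
    then have "a \<in> {1..m}" "c \<in> {1..m}"
      using ac by (blast intro: subsetD)+
    ultimately have pair: "{a, c} \<in> ?V"
      by (simp add: pair_in_verts_triangular_graph)
    have "e \<inter> {a, c} \<noteq> {}" "{a, c} \<inter> f \<noteq> {}"
      using ac by auto
    then have "e \<rightarrow>\<^sup>*\<^bsub>triangular_graph m\<^esub> {a, c}" "{a, c} \<rightarrow>\<^sup>*\<^bsub>triangular_graph m\<^esub> f"
      using meet[OF ef(1) pair] meet[OF pair ef(2)] by simp_all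
    then show ?thesis
      by (rule reachable_trans)
  qed (use ef meet in simp)
  \<comment> \<open>Connectedness includes nonemptiness of the vertex set.\<close>
  moreover have "{1, 2} \<in> ?V"
    using assms by (simp add: pair_in_verts_triangular_graph)
  ultimately show ?thesis
    unfolding connected_iff_reachable by blast
qed

lemma graph_delete_verts:
  assumes "graph G"
  shows "graph (delete_verts G S)"
proof -
  interpret graph G
    by (rule assms)
  have ind: "induced_subgraph (delete_verts G S) G"
    unfolding delete_verts_def by (rule induced_induce) auto
  interpret D: digraph "delete_verts G S"
    using ind by (rule digraphI_induced)
  interpret D: sym_digraph "delete_verts G S"
    using ind by (rule induced_graph_imp_graph)
  show ?thesis
    by unfold_locales
qed

lemma verts_delete_verts [simp]: "verts (delete_verts G S) = verts G - S"
  by (simp add: delete_verts_def)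

lemma adj_delete_triangular_graph:
  "e \<rightarrow>\<^bsub>delete_verts (triangular_graph m) S\<^esub> f \<longleftrightarrow>
    e \<in> verts (triangular_graph m) - S \<and> f \<in> verts (triangular_graph m) - S \<and>
    e \<noteq> f \<and> e \<inter> f \<noteq> {}"
proof -
  have "e \<rightarrow>\<^bsub>delete_verts (triangular_graph m) S\<^esub> f \<longleftrightarrow>
    e \<in> verts (triangular_graph m) - S \<and> f \<in> verts (triangular_graph m) - S \<and>
    card (e \<inter> f) = 1"
    by (auto simp: delete_verts_def triangular_graph_def arcs_ends_conv)
  then show ?thesis
    by (auto simp: verts_triangular_graph card_Int_eq_Suc_0_iff)
qed

text \<open>Working form of the definition, purely in terms of reachability and adjacency after
  deletion.\<close>

lemma disconnecting_set2_triangular_graph_iff: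
  assumes "m \<ge> 2"
  shows "disconnecting_set2 (triangular_graph m) S \<longleftrightarrow>
    S \<subset> verts (triangular_graph m) \<and>
    (\<exists>u v. u \<in> verts (triangular_graph m) - S \<and> v \<in> verts (triangular_graph m) - S \<and>
      \<not> u \<rightarrow>\<^sup>*\<^bsub>delete_verts (triangular_graph m) S\<^esub> v) \<and>
    (\<forall>u \<in> verts (triangular_graph m) - S. \<exists>v. u \<rightarrow>\<^bsub>delete_verts (triangular_graph m) S\<^esub> v)"
proof -
  interpret D: graph "delete_verts (triangular_graph m) S"
    by (intro graph_delete_verts graph_triangular_graph)
  show ?thesis
    unfolding disconnecting_set2_def disconnecting_set_def
      D.component_card_ge_2_iff D.connected_iff_reachable
    using connected_triangular_graph[OF assms] by auto
qed

section \<open>From a disconnecting set to a partition of the points\<close>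

lemma card_Un_pairs_ge_3:
  assumes "card e = 2" "card f = 2" "e \<noteq> f"
  shows "card (e \<union> f) \<ge> 3"
proof (rule ccontr)
  assume "\<not> card (e \<union> f) \<ge> 3"
  moreover have "finite e" "finite f"
    using assms card.infinite by fastforce+
  \<comment> \<open>A union with at most two elements is filled by each of the two pairs.\<close>
  ultimately have "e = e \<union> f" "f = e \<union> f"
    by (intro card_seteq; use assms in simp)+
  with assms(3) show False
    by simp
qed

text \<open>\<open>A\<close> consists of the points covered by the class of some \<open>u\<close>.
  The class of a vertex \<open>v\<close> not reachable from \<open>u\<close> covers only points
  outside \<open>A\<close>, which bounds the complement from below.\<close>

lemma disconnecting_set2_imp_edges_between:
  assumes "m \<ge> 2" and S: "disconnecting_set2 (triangular_graph m) S"
  obtains A where "A \<subseteq> {1..m}" "card A \<ge> 3" "card ({1..m} - A) \<ge> 3"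
    "edges_between A ({1..m} - A) \<subseteq> S"
proof -
  let ?D = "delete_verts (triangular_graph m) S"
  interpret D: graph ?D
    by (intro graph_delete_verts graph_triangular_graph)
  obtain u v where u: "u \<in> verts ?D" and v: "v \<in> verts ?D" and uv: "\<not> u \<rightarrow>\<^sup>*\<^bsub>?D\<^esub> v"
    and nbr: "\<And>w. w \<in> verts ?D \<Longrightarrow> \<exists>z. w \<rightarrow>\<^bsub>?D\<^esub> z"
    using S unfolding disconnecting_set2_triangular_graph_iff[OF assms(1)] by auto
  have D: "e \<subseteq> {1..m}" "card e = 2" if "e \<in> verts ?D" for e
    using that by (simp_all add: verts_triangular_graph)
  have D_reach: "w \<subseteq> {1..m}" if "x \<rightarrow>\<^sup>*\<^bsub>?D\<^esub> w" for x w
    using D.reachable_in_verts(2)[OF that] by (rule D)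
  have step: "x \<rightarrow>\<^sup>*\<^bsub>?D\<^esub> f"
    if "x \<rightarrow>\<^sup>*\<^bsub>?D\<^esub> e" "f \<in> verts ?D" "e \<inter> f \<noteq> {}" for x e f
  proof (cases "e = f")
    case False
    then have "e \<rightarrow>\<^bsub>?D\<^esub> f"
      using that D.reachable_in_verts[OF that(1)] by (auto simp: adj_delete_triangular_graph)
    with that(1) show ?thesis
      by (rule D.reachable_adj_trans)
  qed (use that in simp)
  \<comment> \<open>The class of \<open>x\<close> contains \<open>x\<close> and a neighbour
    \<open>z\<close>, two different pairs.\<close>
  have three: "card (\<Union>{w. x \<rightarrow>\<^sup>*\<^bsub>?D\<^esub> w}) \<ge> 3" if x: "x \<in> verts ?D" for x
  proof -
    obtain z where z: "x \<rightarrow>\<^bsub>?D\<^esub> z"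
      using nbr[OF x] by blast
    have "finite (\<Union>{w. x \<rightarrow>\<^sup>*\<^bsub>?D\<^esub> w})"
      by (rule finite_subset[of _ "{1..m}"]) (use D_reach in \<open>blast, simp\<close>)
    moreover have "x \<union> z \<subseteq> \<Union>{w. x \<rightarrow>\<^sup>*\<^bsub>?D\<^esub> w}"
      using D.reachable_refl[OF x] D.reachable_adjI[OF z] by blast
    moreover have "card (x \<union> z) \<ge> 3"
      using z D x by (intro card_Un_pairs_ge_3) (auto simp: adj_delete_triangular_graph)
    ultimately show ?thesis
      by (meson card_mono le_trans)
  qed
  define A where "A = \<Union>{w. u \<rightarrow>\<^sup>*\<^bsub>?D\<^esub> w}"
  have A: "A \<subseteq> {1..m}"
    unfolding A_def using D_reach by blast
  \<comment> \<open>A point covered by both classes would lie in intersecting pairs \<open>e\<close>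
    and \<open>f\<close>, one from each class, and so join \<open>u\<close> to
    \<open>v\<close>.\<close>
  have "\<Union>{w. v \<rightarrow>\<^sup>*\<^bsub>?D\<^esub> w} \<subseteq> {1..m} - A"
  proof (intro subsetI DiffI notI)
    fix x assume "x \<in> \<Union>{w. v \<rightarrow>\<^sup>*\<^bsub>?D\<^esub> w}"
    then obtain f where f: "v \<rightarrow>\<^sup>*\<^bsub>?D\<^esub> f" "x \<in> f"
      by blast
    then show "x \<in> {1..m}"
      using D_reach by blast
    assume "x \<in> A"
    then obtain e where e: "u \<rightarrow>\<^sup>*\<^bsub>?D\<^esub> e" "x \<in> e"
      unfolding A_def by blast
    then have "u \<rightarrow>\<^sup>*\<^bsub>?D\<^esub> f"
      using f step D.reachable_in_verts(2) by blast
    then show False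
      using f(1) uv D.symmetric_reachable' D.reachable_trans by blast
  qed
  then have "card (\<Union>{w. v \<rightarrow>\<^sup>*\<^bsub>?D\<^esub> w}) \<le> card ({1..m} - A)"
    by (intro card_mono) auto
  then have "card ({1..m} - A) \<ge> 3"
    using three[OF v] by simp
  moreover have "edges_between A ({1..m} - A) \<subseteq> S"
  proof
    fix e assume "e \<in> edges_between A ({1..m} - A)"
    then obtain a b where ab: "a \<in> A" "b \<in> {1..m} - A" "e = {a, b}"
      unfolding in_edges_between_iff by blast
    \<comment> \<open>If it survived, \<open>e\<close> would share \<open>a\<close> with a pair in
      the class of \<open>u\<close>, hence belong to that class and put \<open>b\<close> into
      \<open>A\<close>.\<close>
    show "e \<in> S"
    proof (rule ccontr)
      assume "e \<notin> S"
      moreover have "a \<noteq> b"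
        using ab by auto
      ultimately have "e \<in> verts ?D"
        using ab A by (auto simp: pair_in_verts_triangular_graph)
      moreover obtain f where "u \<rightarrow>\<^sup>*\<^bsub>?D\<^esub> f" "a \<in> f"
        using ab(1) unfolding A_def by blast
      ultimately have "u \<rightarrow>\<^sup>*\<^bsub>?D\<^esub> e"
        using ab step by blast
      then show False
        using ab unfolding A_def by auto
    qed
  qed
  ultimately show ?thesis
    using that A three[OF u] unfolding A_def by blast
qed

section \<open>From a partition of the points to a disconnecting set\<close>

lemma edges_between_subset_verts:
  assumes "A \<subseteq> {1..m}"
  shows "edges_between A ({1..m} - A) \<subseteq> verts (triangular_graph m)"
proof
  fix e assume "e \<in> edges_between A ({1..m} - A)"
  then obtain a b where "e = {a, b}" "a \<in> A" "b \<in> {1..m}" "b \<notin> A"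
    unfolding in_edges_between_iff by blast
  moreover from this have "a \<in> {1..m}"
    using assms by blast
  ultimately show "e \<in> verts (triangular_graph m)"
    by (auto simp: pair_in_verts_triangular_graph)
qed

lemma vert_notin_edges_between_iff:
  assumes "A \<subseteq> {1..m}" "e \<in> verts (triangular_graph m)"
  shows "e \<notin> edges_between A ({1..m} - A) \<longleftrightarrow> e \<subseteq> A \<or> e \<subseteq> {1..m} - A"
proof -
  obtain a b where e: "e = {a, b}" "a \<in> {1..m}" "b \<in> {1..m}"
    using assms(2) by (rule verts_triangular_graphE)
  have "e \<in> edges_between A ({1..m} - A) \<longleftrightarrow> (a \<in> A \<longleftrightarrow> b \<notin> A)"
    unfolding in_edges_between_iff e(1) doubleton_eq_iff using e(2,3) by blast
  then show ?thesis
    using e by auto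
qed

text \<open>Surviving pairs lie within one part, and pairs in different parts are disjoint. A part
  with three points leaves no pair in it isolated.\<close>

lemma disconnecting_set2_edges_between:
  assumes A: "A \<subseteq> {1..m}" "card A \<ge> 3" "card ({1..m} - A) \<ge> 3"
  shows "disconnecting_set2 (triangular_graph m) (edges_between A ({1..m} - A))"
proof -
  let ?B = "{1..m} - A"
  let ?V = "verts (triangular_graph m)"
  let ?S = "edges_between A ?B"
  let ?D = "delete_verts (triangular_graph m) ?S"
  interpret D: graph ?D
    by (intro graph_delete_verts graph_triangular_graph)
  have "card A \<le> m"
    using card_mono[OF _ A(1)] by simp
  then have m: "m \<ge> 2"
    using A(2) by simp
  note notin = vert_notin_edges_between_iff[OF A(1)]
  have pair: "\<exists>e. e \<in> ?V \<and> e \<subseteq> X" if X: "X \<subseteq> {1..m}" "card X \<ge> 3" for X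
  proof -
    obtain e where "e \<subseteq> X" "card e = 2"
      using obtain_subset_with_card_n[of 2 X] X(2) by auto
    with X(1) show ?thesis
      by (auto simp: verts_triangular_graph)
  qed
  obtain u v where u: "u \<in> ?V" "u \<subseteq> A" and v: "v \<in> ?V" "v \<subseteq> ?B"
    using pair[of A] pair[of ?B] A by auto
  have uv: "u \<in> ?V - ?S" "v \<in> ?V - ?S"
    using u v notin by auto
  \<comment> \<open>Along an arc the next pair survives, so it lies within one part, and it meets a
    pair inside \<open>A\<close>.\<close>
  have "w \<subseteq> A" if "u \<rightarrow>\<^sup>*\<^bsub>?D\<^esub> w" for w
    using that
  proof (induction rule: D.reachable_induct)
    case (step x y)
    then show ?case
      using notin[of y] by (auto simp: adj_delete_triangular_graph)
  qed (rule u)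
  moreover have "\<not> v \<subseteq> A"
    using v by (auto elim: verts_triangular_graphE)
  ultimately have "\<not> u \<rightarrow>\<^sup>*\<^bsub>?D\<^esub> v"
    by blast
  moreover have "\<exists>f. e \<rightarrow>\<^bsub>?D\<^esub> f" if e: "e \<in> ?V - ?S" for e
  proof -
    obtain X where X: "X = A \<or> X = ?B" "e \<subseteq> X"
      using e notin[of e] by auto
    have Xm: "X \<subseteq> {1..m}" "card X \<ge> 3"
      using X(1) A by auto
    obtain a b where ab: "e = {a, b}" "a \<noteq> b"
      using e by (auto elim: verts_triangular_graphE)
    \<comment> \<open>A third point \<open>c\<close> of the part gives the neighbour
      \<open>{a, c}\<close> of \<open>e\<close>.\<close>
    have "\<not> X \<subseteq> e"
      using Xm card_mono[of e X] ab by auto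
    then obtain c where c: "c \<in> X" "c \<notin> e"
      by blast
    have f: "{a, c} \<in> ?V" "{a, c} \<subseteq> X"
      using X(2) ab c Xm by (auto simp: pair_in_verts_triangular_graph)
    have "{a, c} \<subseteq> A \<or> {a, c} \<subseteq> ?B"
      using X(1) f(2) by auto
    then have "{a, c} \<notin> ?S"
      unfolding notin[OF f(1)] .
    then have "e \<rightarrow>\<^bsub>?D\<^esub> {a, c}"
      using e f(1) ab c by (auto simp: adj_delete_triangular_graph)
    then show ?thesis ..
  qed
  moreover have "?S \<subset> ?V"
    using uv edges_between_subset_verts[OF A(1)] by blast
  ultimately show ?thesis
    unfolding disconnecting_set2_triangular_graph_iff[OF m] using uv by blast
qed

section \<open>The neighbourhood of a triangle and its images under permutations\<close>

text \<open>The three pairs are all the pairs inside \<open>{1, 2, 3}\<close>, so a neighbour is a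
  pair with exactly one end there.\<close>

lemma neighbours_triangle:
  assumes "m \<ge> 3"
  shows "neighbours (triangular_graph m) {{1, 2}, {1, 3}, {2, 3}} =
    edges_between {1, 2, 3} ({1..m} - {1, 2, 3})" (is "?N = ?E")
proof -
  let ?V = "verts (triangular_graph m)"
  let ?T = "{{1, 2}, {1, 3}, {2, 3::nat}}"
  have sub: "{1, 2, 3} \<subseteq> {1..m}"
    using assms by auto
  have T: "e \<in> ?T \<longleftrightarrow> e \<subseteq> {1, 2, 3}" if "e \<in> ?V" for e
    using that by (rule verts_triangular_graphE) (auto simp: doubleton_eq_iff)
  have TV: "?T \<subseteq> ?V"
    using assms by (simp add: pair_in_verts_triangular_graph)
  have "e \<in> ?N \<longleftrightarrow> e \<in> ?E" if e: "e \<in> ?V" for e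
  proof -
    have "e \<in> ?N \<longleftrightarrow> e \<notin> ?T \<and> (\<exists>x\<in>?T. e \<rightarrow>\<^bsub>triangular_graph m\<^esub> x)"
      using e unfolding neighbours_def by blast
    \<comment> \<open>Since \<open>e\<close> differs from every \<open>x\<close> in
      \<open>?T\<close>, adjacency just means intersecting.\<close>
    also have "\<dots> \<longleftrightarrow> e \<notin> ?T \<and> (\<exists>x\<in>?T. e \<inter> x \<noteq> {})"
      using e TV by (auto simp: adj_triangular_graph verts_triangular_graph card_Int_eq_Suc_0_iff)
    also have "\<dots> \<longleftrightarrow> \<not> e \<subseteq> {1, 2, 3} \<and> \<not> e \<subseteq> {1..m} - {1, 2, 3}"
      using T[OF e] e by (auto simp: verts_triangular_graph)
    also have "\<dots> \<longleftrightarrow> e \<in> ?E"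
      using vert_notin_edges_between_iff[OF sub e] by blast
    finally show ?thesis .
  qed
  moreover have "?N \<subseteq> ?V"
    by (auto simp: neighbours_def)
  ultimately show ?thesis
    using edges_between_subset_verts[OF sub] by blast
qed

text \<open>Permutations of the points carry \<open>{1, 2, 3}\<close> to every 3-subset, so the
  orbit becomes a family indexed by 3-subsets.\<close>

lemma permuted_neighbours_triangle:
  assumes "m \<ge> 3"
  shows "{(\<lambda>e. \<pi> ` e) ` neighbours (triangular_graph m) {{1, 2}, {1, 3}, {2, 3}} | \<pi>. \<pi> permutes {1..m}} =
    {edges_between A ({1..m} - A) | A. A \<subseteq> {1..m} \<and> card A = 3}" (is "?L = ?R")
proof -
  have sub: "{1, 2, 3} \<subseteq> {1..m}"
    using assms by auto
  have img: "(`) \<pi> ` neighbours (triangular_graph m) {{1, 2}, {1, 3}, {2, 3}} =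
      edges_between (\<pi> ` {1, 2, 3}) ({1..m} - \<pi> ` {1, 2, 3})" if "\<pi> permutes {1..m}" for \<pi>
    unfolding neighbours_triangle[OF assms] image_edges_between
      image_set_diff[OF permutes_inj[OF that]] permutes_image[OF that] ..
  show ?thesis
  proof (intro equalityI subsetI)
    fix S assume "S \<in> ?L"
    then obtain \<pi> where \<pi>: "\<pi> permutes {1..m}"
      and S: "S = (`) \<pi> ` neighbours (triangular_graph m) {{1, 2}, {1, 3}, {2, 3}}"
      by blast
    have "\<pi> ` {1, 2, 3} \<subseteq> {1..m}"
      using image_mono[OF sub, of \<pi>] unfolding permutes_image[OF \<pi>] .
    moreover have "card (\<pi> ` {1, 2, 3}) = card {1, 2, 3::nat}"
      by (intro card_image inj_on_subset[OF permutes_inj[OF \<pi>]]) simp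
    ultimately show "S \<in> ?R"
      unfolding S img[OF \<pi>] by auto
  next
    fix S assume "S \<in> ?R"
    then obtain A where A: "A \<subseteq> {1..m}" "card A = 3" and S: "S = edges_between A ({1..m} - A)"
      by blast
    have "card {1, 2, 3::nat} = card A"
      using A by simp
    then obtain \<pi> where \<pi>: "\<pi> permutes {1..m}" "\<pi> ` {1, 2, 3} = A"
      using permutes_extend_card_eq[OF _ sub A(1)] by blast
    then show "S \<in> ?L"
      using img[OF \<pi>(1)] S by blast
  qed
qed

theorem proposition4p1:
  fixes m :: nat
  assumes "m \<ge> 6"
  shows "kappa2 (triangular_graph m) = enat (3 * m - 9) \<and>
    {S. disconnecting_set2 (triangular_graph m) S \<and> card S = 3 * m - 9} =
    {(\<lambda>e. \<pi> ` e) ` neighbours (triangular_graph m) {{1, 2}, {1, 3}, {2, 3}} | \<pi>. \<pi> permutes {1..m}}"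
proof -
  let ?E = "\<lambda>A. edges_between A ({1..m} - A)"
  have m: "m \<ge> 2" "m \<ge> 3"
    using assms by simp_all
  have card_E: "card (?E A) = card A * card ({1..m} - A)" for A
    by (rule card_edges_between) auto
  have card_sum: "card A + card ({1..m} - A) = m" if "A \<subseteq> {1..m}" for A
    using card_mono[OF _ that] finite_subset[OF that] that by (simp add: card_Diff_subset)
  \<comment> \<open>The lower bound and its equality case both come from the same cut contained in
    \<open>S\<close>.\<close>
  have min: "card S \<ge> 3 * m - 9 \<and>
      (card S = 3 * m - 9 \<longrightarrow> (\<exists>A. A \<subseteq> {1..m} \<and> card A = 3 \<and> S = ?E A))"
    if S: "disconnecting_set2 (triangular_graph m) S" for S
  proof -
    obtain A where A: "A \<subseteq> {1..m}" "card A \<ge> 3" "card ({1..m} - A) \<ge> 3" "?E A \<subseteq> S"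
      using disconnecting_set2_imp_edges_between[OF m(1) S] .
    interpret graph "triangular_graph m"
      by (rule graph_triangular_graph)
    have "finite S"
      using S finite_verts finite_subset unfolding disconnecting_set2_def disconnecting_set_def
      by blast
    then have le: "card (?E A) \<le> card S"
      using A(4) by (rule card_mono)
    note bound = mult_ge_if_sum_eq[OF card_sum[OF A(1)] A(2,3), folded card_E]
    have "\<exists>A. A \<subseteq> {1..m} \<and> card A = 3 \<and> S = ?E A" if "card S = 3 * m - 9"
    proof -
      have eq: "card (?E A) = 3 * m - 9"
        using le bound(1) that by simp
      then have S_eq: "S = ?E A"
        using card_subset_eq[OF \<open>finite S\<close> A(4)] that by simp
      from bound(2)[OF eq] show ?thesis
      proof
        \<comment> \<open>The cut is symmetric in its two parts, so the complement can serve as the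
          required 3-subset.\<close>
        assume "card ({1..m} - A) = 3"
        moreover have "S = ?E ({1..m} - A)"
          using S_eq A(1) by (simp add: edges_between_commute double_diff)
        ultimately show ?thesis
          by blast
      qed (use A S_eq in blast)
    qed
    with le bound(1) show ?thesis
      by simp
  qed
  have attained: "disconnecting_set2 (triangular_graph m) (?E A) \<and> card (?E A) = 3 * m - 9"
    if A: "A \<subseteq> {1..m}" "card A = 3" for A
  proof -
    have card_B: "card ({1..m} - A) = m - 3"
      using card_sum[OF A(1)] A(2) by simp
    \<comment> \<open>Here \<open>m \<ge> 6\<close> ensures that the complement also has three
      points.\<close>
    then have "disconnecting_set2 (triangular_graph m) (?E A)"
      using A assms by (intro disconnecting_set2_edges_between) simp_all
    then show ?thesis
      unfolding card_E card_B A(2) by (simp add: diff_mult_distrib2)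
  qed
  have "kappa2 (triangular_graph m) = enat (3 * m - 9)"
  proof (rule antisym)
    have "{1, 2, 3} \<subseteq> {1..m}" "card {1, 2, 3::nat} = 3"
      using m by auto
    note * = attained[OF this]
    then have "kappa2 (triangular_graph m) \<le> enat (card (?E {1, 2, 3}))"
      unfolding kappa2_def by (intro INF_lower) blast
    with * show "kappa2 (triangular_graph m) \<le> enat (3 * m - 9)"
      by simp
    show "enat (3 * m - 9) \<le> kappa2 (triangular_graph m)"
      unfolding kappa2_def using min by (intro INF_greatest) simp
  qed
  moreover have "{S. disconnecting_set2 (triangular_graph m) S \<and> card S = 3 * m - 9} =
      {?E A | A. A \<subseteq> {1..m} \<and> card A = 3}"
    using min attained by blast
  ultimately show ?thesis
    unfolding permuted_neighbours_triangle[OF m(2)] by blast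
qed

end
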